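(* Let $n\ge 3$. If $L$ is a bifix-free regular language over a finite alphabet $\Sigma$ with $\kappa(L)=n$, then $\kappa(L^R)\le 2^{n-3}+2$, where $L^R=\{w^R\mid w\in L\}$ is the reverse of $L$. Moreover, for every $n\ge3$ there exists a factor-free regular language $L$ over a three-letter alphabet with $\kappa(L)=n$ that meets this bound, i.e. $\kappa(L^R)=2^{n-3}+2$.
   Context: For a language $L\subseteq\Sigma^*$ over a finite non-empty alphabet $\Sigma$ and a word $w\in\Sigma^*$, the (left) quotient of $L$ by $w$ is $L_w=\{x\in\Sigma^*\mid wx\in L\}$. The quotient complexity $\kappa(L)$ of a regular language $L$ is the number of distinct quotients $L_w$, $w\in\Sigma^*$; it equals the number of states of the minimal complete deterministic finite automaton accepting $L$ over $\Sigma$. The reverse $w^R$ of a word $w$ is $w$ written backwards. If $w=uxv$ with $u,x,v\in\Sigma^*$, then $u$ is a prefix, $x$ a factor, and $v$ a suffix of $w$. A language $L$ is prefix-free (respectively suffix-free, factor-free) if, whenever $u,v\in L$ and $u$ is a prefix (respectively suffix, factor) of $v$, then $u=v$. A language is bifix-free if it is both prefix-free and suffix-free. *)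

theory Defs
  imports Main "HOL-Library.Sublist"
begin

text \<open>
  An alphabet is a finite non-empty set \<open>\<Sigma>\<close> of letters of some type; words are lists and
  \<open>lists \<Sigma>\<close> is the set of all words over \<open>\<Sigma>\<close>. The alphabet is an explicit parameter because
  quotient complexity depends on it.
\<close>

definition is_dfa ::
  "'a set \<Rightarrow> 's set \<Rightarrow> ('s \<Rightarrow> 'a \<Rightarrow> 's) \<Rightarrow> 's \<Rightarrow> 's set \<Rightarrow> bool" where
  "is_dfa \<Sigma> Q \<delta> q0 F \<longleftrightarrow>
     finite Q \<and> q0 \<in> Q \<and> F \<subseteq> Q \<and> (\<forall>q\<in>Q. \<forall>a\<in>\<Sigma>. \<delta> q a \<in> Q)"

definition dfa_lang ::
  "'a set \<Rightarrow> ('s \<Rightarrow> 'a \<Rightarrow> 's) \<Rightarrow> 's \<Rightarrow> 's set \<Rightarrow> 'a list set" where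
  "dfa_lang \<Sigma> \<delta> q0 F = {w \<in> lists \<Sigma>. foldl \<delta> q0 w \<in> F}"

text \<open>
  States may be taken to be natural numbers, since the state set is finite. The equation
  includes \<open>L \<subseteq> lists \<Sigma>\<close>.
\<close>

definition regular_lang :: "'a set \<Rightarrow> 'a list set \<Rightarrow> bool" where
  "regular_lang \<Sigma> L \<longleftrightarrow>
     (\<exists>(Q :: nat set) \<delta> q0 F. is_dfa \<Sigma> Q \<delta> q0 F \<and> L = dfa_lang \<Sigma> \<delta> q0 F)"

definition quotient_by :: "'a set \<Rightarrow> 'a list set \<Rightarrow> 'a list \<Rightarrow> 'a list set" where
  "quotient_by \<Sigma> L w = {x \<in> lists \<Sigma>. w @ x \<in> L}"

text \<open>
  As \<open>card\<close> is 0 on infinite sets, this is meaningful only when there are finitely many quotients,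
  in particular for regular languages.
\<close>

definition quotient_complexity :: "'a set \<Rightarrow> 'a list set \<Rightarrow> nat" where
  "quotient_complexity \<Sigma> L = card (quotient_by \<Sigma> L ` lists \<Sigma>)"

definition prefix_free :: "'a list set \<Rightarrow> bool" where
  "prefix_free L \<longleftrightarrow> (\<forall>u\<in>L. \<forall>v\<in>L. prefix u v \<longrightarrow> u = v)"

definition suffix_free :: "'a list set \<Rightarrow> bool" where
  "suffix_free L \<longleftrightarrow> (\<forall>u\<in>L. \<forall>v\<in>L. suffix u v \<longrightarrow> u = v)"

text \<open>The library's \<open>sublist\<close> is the contiguous one, i.e. the factor relation.\<close>

definition factor_free :: "'a list set \<Rightarrow> bool" where
  "factor_free L \<longleftrightarrow> (\<forall>u\<in>L. \<forall>v\<in>L. sublist u v \<longrightarrow> u = v)"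

definition bifix_free :: "'a list set \<Rightarrow> bool" where
  "bifix_free L \<longleftrightarrow> prefix_free L \<and> suffix_free L"

definition reverse_lang :: "'a list set \<Rightarrow> 'a list set" where
  "reverse_lang L = {rev w | w. w \<in> L}"

end

theory Submission
  imports Defs
begin

text \<open>
  A quotient of the reverse of \<open>L\<close> by \<open>rev w\<close> is determined by the set of quotients of \<open>L\<close> that
  contain \<open>w\<close>. If \<open>L\<close> is prefix-free, the quotient \<open>{[]}\<close> lies in this set only for
  \<open>w = []\<close>, and then it is the only element; if \<open>L\<close> is suffix-free, the same holds for the quotient
  \<open>L\<close> and \<open>w \<in> L\<close>. The empty quotient is never an element. This leaves \<open>2 ^ (n - 3) + 2\<close> sets.

  For the lower bound put \<open>m = n - 3\<close> and let \<open>m\<close> states lie on a cycle. Both \<open>a\<close> and \<open>b\<close> advance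
  along the cycle, except that \<open>b\<close> sends the last state to a sink. A word of length \<open>m\<close> over
  \<open>a\<close>, \<open>b\<close> thus decides for each state separately whether it survives. The letter \<open>c\<close> enters
  the cycle from the initial state and leaves it to the only final state, which makes the
  language factor-free.
\<close>

section \<open>Quotients of the reverse and the upper bound\<close>

text \<open>Reversing words maps each right quotient of \<open>L\<close> bijectively onto a left
  quotient of its reverse, so the later counting takes place in \<open>L\<close> itself.\<close>

lemma quotient_complexity_reverse:
  assumes "L \<subseteq> lists \<Sigma>"
  shows "quotient_complexity \<Sigma> (reverse_lang L) =
    card ((\<lambda>w. {u \<in> lists \<Sigma>. u @ w \<in> L}) ` lists \<Sigma>)"
proof -
  have rev_image: "rev ` A = {x. rev x \<in> A}" for A :: "'a list set"
  proof (intro set_eqI iffI)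
    fix x assume "x \<in> {x. rev x \<in> A}"
    then have "rev (rev x) \<in> rev ` A" by blast
    then show "x \<in> rev ` A" by simp
  qed auto
  have rev_mem: "x \<in> reverse_lang L \<longleftrightarrow> rev x \<in> L" for x
  proof -
    have "reverse_lang L = rev ` L" unfolding reverse_lang_def by blast
    then show ?thesis using rev_image[of L] by simp
  qed
  have rev_lists: "rev ` lists \<Sigma> = lists \<Sigma>"
    unfolding rev_image by (simp add: in_lists_conv_set set_eq_iff)
  have "quotient_by \<Sigma> (reverse_lang L) w = rev ` {u \<in> lists \<Sigma>. u @ rev w \<in> L}" for w
    unfolding quotient_by_def rev_image by (simp add: rev_mem in_lists_conv_set)
  then have "quotient_by \<Sigma> (reverse_lang L) ` lists \<Sigma> =
      image rev ` (\<lambda>w. {u \<in> lists \<Sigma>. u @ w \<in> L}) ` rev ` lists \<Sigma>"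
    by (simp add: image_image)
  moreover have "inj (image (rev :: 'a list \<Rightarrow> 'a list))"
    by (simp add: inj_image_eq_iff inj_on_def)
  ultimately show ?thesis
    unfolding quotient_complexity_def rev_lists
    by (simp add: card_image[OF inj_on_subset[OF _ subset_UNIV]])
qed

lemma quotient_complexity_reverse_le:
  assumes L: "L \<subseteq> lists \<Sigma>" and bif: "bifix_free L" and n: "quotient_complexity \<Sigma> L = n" "n \<ge> 3"
  shows "quotient_complexity \<Sigma> (reverse_lang L) \<le> 2 ^ (n - 3) + 2"
proof -
  define Q where "Q = quotient_by \<Sigma> L ` lists \<Sigma>"
  have cQ: "card Q = n" using n(1) unfolding quotient_complexity_def Q_def .
  then have fQ: "finite Q" using n(2) by (metis card.infinite not_numeral_le_zero)
  have pf: "v = []" if "u \<in> L" "u @ v \<in> L" for u v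
    using bif that unfolding bifix_free_def prefix_free_def
    by (metis prefixI self_append_conv)
  have sf: "u = []" if "v \<in> L" "u @ v \<in> L" for u v
    using bif that unfolding bifix_free_def suffix_free_def
    by (metis append_self_conv2 suffixI)
  have eps: "quotient_by \<Sigma> L w = {[]}" if "w \<in> L" for w
  proof -
    have "w @ x \<in> L \<longleftrightarrow> x = []" for x using pf[OF that, of x] that by auto
    then show ?thesis unfolding quotient_by_def by auto
  qed
  have QL: "L \<in> Q"
    using L unfolding Q_def quotient_by_def by (intro image_eqI[of _ _ "[]"]) auto
  \<comment> \<open>Here and for \<open>nil\<close>, n \<ge> 3 excludes degenerate languages: the
    empty language has one quotient, and \<open>{[]}\<close> has at most two.\<close>
  have "\<exists>w. w \<in> L"
  proof (rule ccontr)
    assume "\<not> ?thesis"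
    then have "Q \<subseteq> {{}}" unfolding Q_def quotient_by_def by auto
    from card_mono[OF _ this] show False using cQ n(2) by simp
  qed
  then obtain w where w: "w \<in> L" by blast
  have wS: "w \<in> lists \<Sigma>" using w L by blast
  have nil: "[] \<notin> L"
  proof
    assume "[] \<in> L"
    then have "L = {[]}" using pf[of "[]"] by auto
    then have "Q \<subseteq> {{[]}, {}}" unfolding Q_def quotient_by_def by auto
    from card_mono[OF _ this] show False using cQ n(2) by simp
  qed
  have Qe: "{[]} \<in> Q" using eps[OF w] wS unfolding Q_def by (metis image_eqI)
  \<comment> \<open>As \<open>w\<close> is not empty, \<open>w @ w\<close> properly extends a word
    of \<open>L\<close>, so no continuation of it lies in \<open>L\<close>.\<close>
  have "quotient_by \<Sigma> L (w @ w) = {}"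
  proof -
    have "w @ w @ x \<notin> L" for x using pf[OF w, of "w @ x"] w nil by auto
    then show ?thesis unfolding quotient_by_def by simp
  qed
  moreover have "w @ w \<in> lists \<Sigma>" using wS by simp
  ultimately have Q0: "{} \<in> Q" unfolding Q_def by (metis image_eqI)
  define P where "P = Q - {L, {[]}, {}}"
  have "L \<noteq> {[]}" "L \<noteq> {}" using w nil by auto
  then have "card {L, {[]}, {}} = 3" by simp
  then have cP: "card P = n - 3"
    unfolding P_def using QL Qe Q0 cQ by (subst card_Diff_subset) auto
  have fP: "finite P" using fQ unfolding P_def by simp
  define S where "S = (\<lambda>w. {K \<in> Q. w \<in> K})"
  have S_mem: "S v \<in> Pow P \<union> {{L}, {{[]}}}" if v: "v \<in> lists \<Sigma>" for v
  proof -
    have uv: "u @ v \<in> L" if "v \<in> quotient_by \<Sigma> L u" for u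
      using that unfolding quotient_by_def by auto
    consider "v = []" | "v \<in> L" | "v \<noteq> []" "v \<notin> L" by blast
    then show ?thesis
    proof cases
      case 1
      have "K = {[]}" if K: "K \<in> Q" "[] \<in> K" for K
      proof -
        obtain u where "K = quotient_by \<Sigma> L u" using K unfolding Q_def by auto
        moreover from this have "u \<in> L" using uv[of u] K unfolding 1 by simp
        ultimately show ?thesis using eps by simp
      qed
      then have "S v = {{[]}}" using Qe unfolding S_def 1 by blast
      then show ?thesis by simp
    next
      case 2
      have "K = L" if K: "K \<in> Q" "v \<in> K" for K
      proof -
        obtain u where u: "K = quotient_by \<Sigma> L u" using K unfolding Q_def by auto
        then have "u @ v \<in> L" using uv[of u] K by simp
        then have "u = []" by (rule sf[OF 2])
        then show ?thesis using L unfolding u quotient_by_def by auto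
      qed
      then have "S v = {L}" using QL 2 unfolding S_def by blast
      then show ?thesis by simp
    next
      case 3
      have "K \<in> P" if K: "K \<in> Q" "v \<in> K" for K
        using K 3 unfolding P_def by auto
      then show ?thesis unfolding S_def by auto
    qed
  qed
  \<comment> \<open>The right quotient by \<open>v\<close> can be recovered from \<open>S v\<close>,
    so there are at most as many right quotients as values of \<open>S\<close>.\<close>
  have "(\<lambda>v. {u \<in> lists \<Sigma>. u @ v \<in> L}) ` lists \<Sigma> =
      (\<lambda>T. {u \<in> lists \<Sigma>. quotient_by \<Sigma> L u \<in> T}) ` S ` lists \<Sigma>"
    unfolding image_image
  proof (intro image_cong refl)
    fix v assume "v \<in> lists \<Sigma>"
    then show "{u \<in> lists \<Sigma>. u @ v \<in> L} = {u \<in> lists \<Sigma>. quotient_by \<Sigma> L u \<in> S v}"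
      unfolding S_def Q_def by (simp add: quotient_by_def conj_commute cong: conj_cong)
  qed
  then have "quotient_complexity \<Sigma> (reverse_lang L) =
      card ((\<lambda>T. {u \<in> lists \<Sigma>. quotient_by \<Sigma> L u \<in> T}) ` S ` lists \<Sigma>)"
    using quotient_complexity_reverse[OF L] by simp
  also have "\<dots> \<le> card (Pow P \<union> {{L}, {{[]}}})"
  proof -
    have sub: "S ` lists \<Sigma> \<subseteq> Pow P \<union> {{L}, {{[]}}}" using S_mem by blast
    have fin: "finite (Pow P \<union> {{L}, {{[]}}})" using fP by simp
    show ?thesis
      using card_image_le[OF finite_subset[OF sub fin]] card_mono[OF fin sub] by (rule order_trans)
  qed
  also have "\<dots> \<le> card (Pow P) + card {{L}, {{[]}}}" by (rule card_Un_le)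
  also have "\<dots> \<le> 2 ^ (n - 3) + 2"
    using fP cP by (simp add: card_Pow card_insert_if)
  finally show ?thesis .
qed

section \<open>Counting quotients by automata\<close>

lemma foldl_in_states:
  assumes "is_dfa \<Sigma> Q \<delta> q0 F" "w \<in> lists \<Sigma>" "q \<in> Q"
  shows "foldl \<delta> q w \<in> Q"
  using assms(2,3,1) by (induction w arbitrary: q) (auto simp: is_dfa_def)

text \<open>Reachability identifies the quotients with the languages accepted from the states;
  distinguishability keeps these apart.\<close>

lemma quotient_complexity_minimal_dfa:
  assumes dfa: "is_dfa \<Sigma> Q \<delta> q0 F"
    and reach: "\<And>q. q \<in> Q \<Longrightarrow> \<exists>w\<in>lists \<Sigma>. foldl \<delta> q0 w = q"
    and dist: "\<And>p q. p \<in> Q \<Longrightarrow> q \<in> Q \<Longrightarrow> p \<noteq> q \<Longrightarrow>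
      \<exists>w\<in>lists \<Sigma>. (foldl \<delta> p w \<in> F) \<noteq> (foldl \<delta> q w \<in> F)"
  shows "quotient_complexity \<Sigma> (dfa_lang \<Sigma> \<delta> q0 F) = card Q"
proof -
  have q0: "q0 \<in> Q" using dfa by (simp add: is_dfa_def)
  have "foldl \<delta> q0 ` lists \<Sigma> = Q"
    using reach foldl_in_states[OF dfa _ q0] by (force simp: image_iff)
  moreover have "quotient_by \<Sigma> (dfa_lang \<Sigma> \<delta> q0 F) ` lists \<Sigma> =
      (\<lambda>q. dfa_lang \<Sigma> \<delta> q F) ` foldl \<delta> q0 ` lists \<Sigma>"
    unfolding image_image
    by (intro image_cong refl) (auto simp: quotient_by_def dfa_lang_def)
  moreover have "inj_on (\<lambda>q. dfa_lang \<Sigma> \<delta> q F) Q"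
    using dist unfolding inj_on_def dfa_lang_def by blast
  ultimately show ?thesis unfolding quotient_complexity_def by (simp add: card_image)
qed

text \<open>The sets counted are the reachable states of the subset construction on the reversed
  automaton. Distinct sets differ in a state, and a word reaching that state separates the right
  quotients.\<close>

lemma quotient_complexity_reverse_dfa:
  assumes dfa: "is_dfa \<Sigma> Q \<delta> q0 F"
    and reach: "\<And>q. q \<in> Q \<Longrightarrow> \<exists>w\<in>lists \<Sigma>. foldl \<delta> q0 w = q"
  shows "quotient_complexity \<Sigma> (reverse_lang (dfa_lang \<Sigma> \<delta> q0 F)) =
    card ((\<lambda>w. {q \<in> Q. foldl \<delta> q w \<in> F}) ` lists \<Sigma>)"
proof -
  have q0: "q0 \<in> Q" using dfa by (simp add: is_dfa_def)
  have sub: "dfa_lang \<Sigma> \<delta> q0 F \<subseteq> lists \<Sigma>" by (auto simp: dfa_lang_def)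
  have "(\<lambda>w. {u \<in> lists \<Sigma>. u @ w \<in> dfa_lang \<Sigma> \<delta> q0 F}) ` lists \<Sigma> =
      (\<lambda>T. {u \<in> lists \<Sigma>. foldl \<delta> q0 u \<in> T}) ` (\<lambda>w. {q \<in> Q. foldl \<delta> q w \<in> F}) ` lists \<Sigma>"
    unfolding image_image using foldl_in_states[OF dfa _ q0]
    by (intro image_cong refl) (auto simp: dfa_lang_def)
  moreover have "inj_on (\<lambda>T. {u \<in> lists \<Sigma>. foldl \<delta> q0 u \<in> T}) (Pow Q)"
  proof (rule inj_onI)
    fix T U assume "T \<in> Pow Q" "U \<in> Pow Q"
      and "{u \<in> lists \<Sigma>. foldl \<delta> q0 u \<in> T} = {u \<in> lists \<Sigma>. foldl \<delta> q0 u \<in> U}"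
    then have "q \<in> T \<longleftrightarrow> q \<in> U" if "q \<in> Q" for q
      using reach[OF that] by blast
    then show "T = U" using \<open>T \<in> Pow Q\<close> \<open>U \<in> Pow Q\<close> by blast
  qed
  then have "inj_on (\<lambda>T. {u \<in> lists \<Sigma>. foldl \<delta> q0 u \<in> T})
      ((\<lambda>w. {q \<in> Q. foldl \<delta> q w \<in> F}) ` lists \<Sigma>)"
    by (rule inj_on_subset) auto
  ultimately show ?thesis
    using quotient_complexity_reverse[OF sub] by (simp add: card_image)
qed

text \<open>
  The letters \<open>a\<close>, \<open>b\<close>, \<open>c\<close> are \<open>0\<close>, \<open>1\<close>, \<open>2\<close>. The initial state is \<open>0\<close>, the cycle is \<open>{1..m}\<close>,
  the final state is \<open>m + 1\<close> and the sink is \<open>m + 2\<close>. For \<open>m = 0\<close> the initial state goes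
  directly to the final state under \<open>c\<close>.
\<close>
definition step :: "nat \<Rightarrow> nat \<Rightarrow> nat \<Rightarrow> nat" where
  "step m q x =
    (if q = 0 then (if x = 2 then 1 else m + 2)
     else if q \<le> m then
       (if x = 2 then m + 1 else if q < m then q + 1 else if x = 0 then 1 else m + 2)
     else m + 2)"

abbreviation ABC :: "nat set" where "ABC \<equiv> {0, 1, 2}"

abbreviation witness :: "nat \<Rightarrow> nat list set" where
  "witness m \<equiv> dfa_lang ABC (step m) 0 {m + 1}"

section \<open>Runs of the witness automaton\<close>

lemma foldl_step_sink [simp]: "foldl (step m) (Suc (Suc m)) w = m + 2"
  by (induction w) (auto simp: step_def)

lemma foldl_step_final: "foldl (step m) (m + 1) w = m + 1 \<longleftrightarrow> w = []"
  by (cases w) (auto simp: step_def)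

lemma foldl_step_advance:
  assumes "2 \<notin> set u" "1 \<le> q" "q + length u \<le> m"
  shows "foldl (step m) q u = q + length u"
  using assms by (induction u arbitrary: q) (auto simp: step_def)

text \<open>A run from \<open>q\<close> is in state \<open>m\<close> after \<open>m - q\<close>
  letters, so only the letter at index \<open>m - q\<close> can send it to the sink. If that letter
  is \<open>0\<close>, the run passes to state \<open>1\<close> and the remaining
  \<open>q - 1\<close> letters lead back to \<open>q\<close>.\<close>

lemma foldl_step_cycle:
  assumes u: "2 \<notin> set u" "length u = m" and q: "1 \<le> q" "q \<le> m"
  shows "foldl (step m) q u = (if u ! (m - q) = 0 then q else m + 2)"
proof -
  have split: "u = take (m - q) u @ u ! (m - q) # drop (Suc (m - q)) u"
    using u q by (intro id_take_nth_drop) simp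
  have "u ! (m - q) \<noteq> 2" using u q by (metis nth_mem diff_less less_le_trans zero_less_one)
  moreover have "foldl (step m) q (take (m - q) u) = m"
    using u q by (subst foldl_step_advance) (auto dest: in_set_takeD)
  moreover have "foldl (step m) 1 (drop (Suc (m - q)) u) = q"
    using u q by (subst foldl_step_advance) (auto dest: in_set_dropD)
  ultimately show ?thesis
    by (subst split) (use q in \<open>auto simp: step_def\<close>)
qed

lemma is_dfa_witness: "is_dfa ABC {..m + 2} (step m) 0 {m + 1}"
  by (auto simp: is_dfa_def step_def)

lemma witness_reachable:
  assumes "q \<in> {..m + 2}"
  shows "\<exists>w\<in>lists ABC. foldl (step m) 0 w = q"
proof -
  have cycle: "foldl (step m) 0 (2 # replicate (q - 1) 0) = q" if "1 \<le> q" "q \<le> m" for q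
    using that by (simp add: step_def foldl_step_advance)
  consider "q = 0" | "1 \<le> q" "q \<le> m" | "q = m + 1" "m = 0" | "q = m + 1" "1 \<le> m" | "q = m + 2"
    using assms by force
  then show ?thesis
  proof cases
    case 1
    then show ?thesis by (intro bexI[of _ "[]"]) auto
  next
    case 2
    then show ?thesis
      by (intro bexI[of _ "2 # replicate (q - 1) 0"] cycle) auto
  next
    case 3
    then show ?thesis by (intro bexI[of _ "[2]"]) (auto simp: step_def)
  next
    case 4
    then show ?thesis by (intro bexI[of _ "[2, 2]"]) (auto simp: step_def)
  next
    case 5
    then show ?thesis by (intro bexI[of _ "[0]"]) (auto simp: step_def)
  qed
qed

lemma witness_subsets:
  assumes "T \<in> Pow {1..m} \<union> {{0}, {m + 1}}"
  shows "\<exists>w\<in>lists ABC. {q \<in> {..m + 2}. foldl (step m) q w \<in> {m + 1}} = T"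
proof -
  consider "T = {}" | "T \<subseteq> {1..m}" "T \<noteq> {}" | "T = {0}" | "T = {m + 1}"
    using assms by blast
  then show ?thesis
  proof cases
    case 1
    \<comment> \<open>Every state is in the sink after three letters \<open>2\<close>, since at most
      two of them lead to the final state.\<close>
    then show ?thesis by (intro bexI[of _ "[2, 2, 2]"]) (auto simp: step_def)
  next
    case 2
    then have m: "1 \<le> m" by fastforce
    \<comment> \<open>Index \<open>i\<close> decides the fate of state \<open>m - i\<close>; a
      closing \<open>2\<close> then takes the survivors to the final state.\<close>
    define u :: "nat list" where "u = map (\<lambda>i. if m - i \<in> T then 0 else 1) [0..<m]"
    have u: "2 \<notin> set u" "length u = m" by (auto simp: u_def)
    have "foldl (step m) q (u @ [2]) = m + 1 \<longleftrightarrow> q \<in> T" if q: "q \<le> m + 2" for q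
    proof (cases "1 \<le> q \<and> q \<le> m")
      case True
      then have "u ! (m - q) = 0 \<longleftrightarrow> q \<in> T" unfolding u_def by (simp add: nth_map)
      then show ?thesis
        using True foldl_step_cycle[OF u, of q] by (auto simp: step_def)
    next
      case False
      \<comment> \<open>Since m \<ge> 1, \<open>u\<close> has a first letter. It is not
        \<open>2\<close>, so it sends every state outside the cycle to the sink.\<close>
      obtain x v where xv: "u = x # v" using u m by (cases u) auto
      have "step m q x = m + 2" using False xv u q by (auto simp: step_def)
      then show ?thesis using False 2 xv by (auto simp: step_def)
    qed
    then have "{q \<in> {..m + 2}. foldl (step m) q (u @ [2]) \<in> {m + 1}} = T"
      using 2 by fastforce
    moreover have "u @ [2] \<in> lists ABC" by (auto simp: u_def)
    ultimately show ?thesis by blast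
  next
    case 3
    \<comment> \<open>For \<open>m = 0\<close> state \<open>1\<close> is already final; otherwise
      the second \<open>2\<close> is needed to leave the cycle.\<close>
    show ?thesis
    proof (cases "m = 0")
      case True
      then show ?thesis using 3 by (intro bexI[of _ "[2]"]) (auto simp: step_def)
    next
      case False
      then show ?thesis using 3
        by (intro bexI[of _ "[2, 2]"]) (auto simp: step_def split: if_splits)
    qed
  next
    case 4
    then show ?thesis by (intro bexI[of _ "[]"]) auto
  qed
qed

section \<open>Complexity and factor-freeness of the witness\<close>

lemma quotient_complexity_witness: "quotient_complexity ABC (witness m) = m + 3"
proof -
  have "\<exists>w\<in>lists ABC. (foldl (step m) p w \<in> {m + 1}) \<noteq> (foldl (step m) q w \<in> {m + 1})"
    if pq: "p \<in> {..m + 2}" "q \<in> {..m + 2}" "p \<noteq> q" for p q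
  proof -
    \<comment> \<open>One of two distinct states is not the sink, and a word accepted from that
      state alone separates them.\<close>
    obtain r where r: "r \<in> {p, q}" "r \<noteq> m + 2" using pq by blast
    then have "{r} \<in> Pow {1..m} \<union> {{0}, {m + 1}}" using pq by auto
    from witness_subsets[OF this] obtain w where w: "w \<in> lists ABC"
      and S: "{q \<in> {..m + 2}. foldl (step m) q w \<in> {m + 1}} = {r}"
      by blast
    have "foldl (step m) s w \<in> {m + 1} \<longleftrightarrow> s = r" if "s \<in> {..m + 2}" for s
      using S that by blast
    then show ?thesis using pq r w by (intro bexI[of _ w]) auto
  qed
  from quotient_complexity_minimal_dfa[OF is_dfa_witness witness_reachable this]
  show ?thesis by simp
qed

lemma factor_free_witness: "factor_free (witness m)"
  unfolding factor_free_def
proof (intro ballI impI)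
  fix v w assume v: "v \<in> witness m" and w: "w \<in> witness m" and "sublist v w"
  then obtain x y where xy: "w = x @ v @ y" by (auto simp: sublist_def)
  have accv: "foldl (step m) 0 v = m + 1" and accw: "foldl (step m) 0 (x @ v @ y) = m + 1"
    using v w xy by (auto simp: dfa_lang_def)
  obtain v' where v': "v = 2 # v'"
    using accv by (cases v) (auto simp: step_def split: if_splits)
  have "x = []"
  proof (rule ccontr)
    assume "x \<noteq> []"
    define p where "p = foldl (step m) 0 x"
    \<comment> \<open>No transition enters the initial state, so the leading \<open>2\<close> of
      \<open>v\<close> is read on the cycle and jumps to the final state.\<close>
    have "p \<noteq> 0"
      using \<open>x \<noteq> []\<close> unfolding p_def by (cases x rule: rev_cases) (auto simp: step_def)
    have accp: "foldl (step m) (step m p 2) (v' @ y) = m + 1"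
      using accw unfolding v' p_def by simp
    then have p: "p \<le> m" using \<open>p \<noteq> 0\<close> by (auto simp: step_def split: if_splits)
    then have "step m p 2 = m + 1" using \<open>p \<noteq> 0\<close> by (auto simp: step_def)
    then have "v' = []" using accp foldl_step_final by (metis append_is_Nil_conv)
    \<comment> \<open>Now \<open>v = [2]\<close>, but a state on the cycle means m \<ge> 1, so
      \<open>[2]\<close> leads from \<open>0\<close> only to state \<open>1\<close>.\<close>
    then show False using accv v' p \<open>p \<noteq> 0\<close> by (simp add: step_def)
  qed
  moreover have "y = []"
    using accw accv foldl_step_final[of m y] \<open>x = []\<close> by simp
  ultimately show "v = w" using xy by simp
qed

lemma factor_free_imp_bifix_free: "factor_free L \<Longrightarrow> bifix_free L"
  unfolding factor_free_def bifix_free_def prefix_free_def suffix_free_def by blast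

lemma quotient_complexity_reverse_witness:
  "quotient_complexity ABC (reverse_lang (witness m)) = 2 ^ m + 2"
proof (rule antisym)
  have sub: "witness m \<subseteq> lists ABC" by (auto simp: dfa_lang_def)
  show "quotient_complexity ABC (reverse_lang (witness m)) \<le> 2 ^ m + 2"
    using quotient_complexity_reverse_le[OF sub
        factor_free_imp_bifix_free[OF factor_free_witness] quotient_complexity_witness]
    by simp
  let ?S = "(\<lambda>w. {q \<in> {..m + 2}. foldl (step m) q w \<in> {m + 1}}) ` lists ABC"
  have "finite ?S" by (rule finite_subset[of _ "Pow {..m + 2}"]) auto
  moreover have "Pow {1..m} \<union> {{0}, {m + 1}} \<subseteq> ?S"
  proof
    fix T assume "T \<in> Pow {1..m} \<union> {{0}, {m + 1}}"
    from witness_subsets[OF this] obtain w where w: "w \<in> lists ABC"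
      and T: "{q \<in> {..m + 2}. foldl (step m) q w \<in> {m + 1}} = T"
      by blast
    show "T \<in> ?S" unfolding T[symmetric] using w by (rule imageI)
  qed
  ultimately have "card (Pow {1..m} \<union> {{0}, {m + 1}}) \<le> card ?S" by (rule card_mono)
  moreover have "card (Pow {1..m} \<union> {{0}, {m + 1}}) = 2 ^ m + 2"
    by (subst card_Un_disjoint) (auto simp: card_Pow)
  moreover note quotient_complexity_reverse_dfa[OF is_dfa_witness witness_reachable, of m]
  ultimately show "2 ^ m + 2 \<le> quotient_complexity ABC (reverse_lang (witness m))" by simp
qed

theorem theorem5:
  shows "(\<forall>n\<ge>3. \<forall>(\<Sigma> :: 'a set) L.
            finite \<Sigma> \<and> \<Sigma> \<noteq> {} \<and> regular_lang \<Sigma> L \<and> bifix_free L \<and>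
            quotient_complexity \<Sigma> L = n
            \<longrightarrow> quotient_complexity \<Sigma> (reverse_lang L) \<le> 2 ^ (n - 3) + 2) \<and>
         (\<forall>n\<ge>3. \<exists>(\<Sigma> :: nat set) L.
            card \<Sigma> = 3 \<and> regular_lang \<Sigma> L \<and> factor_free L \<and>
            quotient_complexity \<Sigma> L = n \<and>
            quotient_complexity \<Sigma> (reverse_lang L) = 2 ^ (n - 3) + 2)"
proof (intro conjI allI impI)
  fix n :: nat and \<Sigma> :: "'a set" and L
  assume n: "3 \<le> n" and
    "finite \<Sigma> \<and> \<Sigma> \<noteq> {} \<and> regular_lang \<Sigma> L \<and> bifix_free L \<and> quotient_complexity \<Sigma> L = n"
  moreover from this have "L \<subseteq> lists \<Sigma>" by (auto simp: regular_lang_def dfa_lang_def)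
  ultimately show "quotient_complexity \<Sigma> (reverse_lang L) \<le> 2 ^ (n - 3) + 2"
    by (intro quotient_complexity_reverse_le) auto
next
  fix n :: nat
  assume n: "3 \<le> n"
  have "regular_lang ABC (witness (n - 3))"
    unfolding regular_lang_def using is_dfa_witness by blast
  then show "\<exists>(\<Sigma> :: nat set) L. card \<Sigma> = 3 \<and> regular_lang \<Sigma> L \<and> factor_free L \<and>
      quotient_complexity \<Sigma> L = n \<and>
      quotient_complexity \<Sigma> (reverse_lang L) = 2 ^ (n - 3) + 2"
    using n factor_free_witness quotient_complexity_witness[of "n - 3"]
      quotient_complexity_reverse_witness[of "n - 3"]
    by (intro exI[of _ ABC] exI[of _ "witness (n - 3)"]) simp
qed

end
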